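(* Let $p>0$ be a fixed real number. For $\alpha=1$ one has $PW_p^{\alpha}=PS^{\alpha}$; that is, $PW_p=PS$, where $PW_p:=PW_p^{1}$ and $PS:=PS^{1}$.
   Context: Throughout $|A|$ denotes the cardinality of a finite set $A$, and all random variables in a sequence, together with its limit, are defined on a common probability space $(S,\triangle,P)$. For $0<\alpha\le 1$, a sequence of random variables $\{X_n\}_{n\in\mathbb{N}}$ is statistically convergent of order $\alpha$ in probability to a random variable $X$ if for all $\varepsilon,\delta>0$, $\lim_{n\to\infty}\frac{1}{n^{\alpha}}|\{k\le n: P(|X_k-X|\ge\varepsilon)\ge\delta\}|=0$. $PS^{\alpha}$ denotes the class of all sequences of random variables which are statistically convergent of order $\alpha$ in probability (to some random variable). For $0<\alpha\le 1$ and a fixed real $p>0$, $\{X_n\}_{n\in\mathbb{N}}$ is strong $p$-Cesàro summable of order $\alpha$ in probability to a random variable $X$ if for every $\varepsilon>0$, $\lim_{n\to\infty}\frac{1}{n^{\alpha}}\sum_{k=1}^{n}\{P(|X_k-X|\ge\varepsilon)\}^p=0$. $PW_p^{\alpha}$ denotes the class of all sequences of random variables which are strong $p$-Cesàro summable of order $\alpha$ in probability (to some random variable). *)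

theory Defs
  imports "HOL-Probability.Probability"
begin

text \<open>
  Sequences are indexed by $k \ge 1$, as in the counting ranges $1 \le k \le n$; the value at
  index 0 is irrelevant and unconstrained. The order \<open>\<alpha>\<close> is meant to range over
  $0 < \alpha \le 1$ and the exponent \<open>p\<close> over the positive reals (note that
  \<open>0 powr p = 0\<close>).
\<close>

definition stat_conv_in_prob ::
    "'a measure \<Rightarrow> real \<Rightarrow> (nat \<Rightarrow> 'a \<Rightarrow> real) \<Rightarrow> ('a \<Rightarrow> real) \<Rightarrow> bool" where
  "stat_conv_in_prob M \<alpha> X Y \<longleftrightarrow>
     (\<forall>\<epsilon>>0. \<forall>\<delta>>0.
        (\<lambda>n. real (card {k \<in> {1..n}. measure M {\<omega> \<in> space M. \<bar>X k \<omega> - Y \<omega>\<bar> \<ge> \<epsilon>} \<ge> \<delta>})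
              / real n powr \<alpha>) \<longlonglongrightarrow> 0)"

definition strong_Cesaro_in_prob ::
    "'a measure \<Rightarrow> real \<Rightarrow> real \<Rightarrow> (nat \<Rightarrow> 'a \<Rightarrow> real) \<Rightarrow> ('a \<Rightarrow> real) \<Rightarrow> bool" where
  "strong_Cesaro_in_prob M p \<alpha> X Y \<longleftrightarrow>
     (\<forall>\<epsilon>>0.
        (\<lambda>n. (\<Sum>k=1..n. measure M {\<omega> \<in> space M. \<bar>X k \<omega> - Y \<omega>\<bar> \<ge> \<epsilon>} powr p)
              / real n powr \<alpha>) \<longlonglongrightarrow> 0)"

definition PS :: "'a measure \<Rightarrow> real \<Rightarrow> (nat \<Rightarrow> 'a \<Rightarrow> real) set" where
  "PS M \<alpha> =
     {X. (\<forall>k\<ge>1. X k \<in> borel_measurable M) \<and>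
         (\<exists>Y \<in> borel_measurable M. stat_conv_in_prob M \<alpha> X Y)}"

definition PW :: "'a measure \<Rightarrow> real \<Rightarrow> real \<Rightarrow> (nat \<Rightarrow> 'a \<Rightarrow> real) set" where
  "PW M p \<alpha> =
     {X. (\<forall>k\<ge>1. X k \<in> borel_measurable M) \<and>
         (\<exists>Y \<in> borel_measurable M. strong_Cesaro_in_prob M p \<alpha> X Y)}"

end

(* For a fixed \<epsilon>, put a k = P(|X k - Y| \<ge> \<epsilon>), a number in [0, 1].  If A is the set of k \<le> n with
   a k \<ge> \<delta>, then \<delta>^p |A| \<le> (\<Sum>k\<le>n. (a k)^p) \<le> |A| + n \<delta>^p.  After division by n the first
   inequality (Markov) gives one inclusion; the second gives the other, and only there is the
   order 1 needed, as the error term n \<delta>^p is of order n. *)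

theory Submission
  imports Defs
begin

text \<open>Markov's inequality for counting measure: each index with
  \<open>a k \<ge> \<delta>\<close> contributes at least \<open>\<delta> powr p\<close>, and the
  discarded terms are nonnegative because \<open>powr\<close> is.\<close>

lemma card_mult_powr_le_sum_powr:
  fixes a :: "nat \<Rightarrow> real"
  assumes "finite A" "p \<ge> 0" "\<delta> > 0"
  shows "\<delta> powr p * real (card {k \<in> A. a k \<ge> \<delta>}) \<le> (\<Sum>k\<in>A. a k powr p)"
proof -
  have "\<delta> powr p * real (card {k \<in> A. a k \<ge> \<delta>}) = (\<Sum>k\<in>{k \<in> A. a k \<ge> \<delta>}. \<delta> powr p)"
    by simp
  also have "\<dots> \<le> (\<Sum>k\<in>{k \<in> A. a k \<ge> \<delta>}. a k powr p)"
    using assms by (intro sum_mono powr_mono2) auto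
  also have "\<dots> \<le> (\<Sum>k\<in>A. a k powr p)"
    using assms by (intro sum_mono2) auto
  finally show ?thesis .
qed

text \<open>Split at the threshold: a term with \<open>a k \<ge> \<delta>\<close> is at most 1 and
  is paid for by the count, any other is at most \<open>\<delta> powr p\<close>.\<close>

lemma sum_powr_le_card_plus:
  fixes a :: "nat \<Rightarrow> real"
  assumes "finite A" "p \<ge> 0" "\<And>k. k \<in> A \<Longrightarrow> 0 \<le> a k" "\<And>k. k \<in> A \<Longrightarrow> a k \<le> 1"
  shows "(\<Sum>k\<in>A. a k powr p) \<le> real (card {k \<in> A. a k \<ge> \<delta>}) + real (card A) * \<delta> powr p"
proof -
  have "(\<Sum>k\<in>A. a k powr p) \<le> (\<Sum>k\<in>A. (if a k \<ge> \<delta> then 1 else 0) + \<delta> powr p)"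
  proof (rule sum_mono)
    fix k assume k: "k \<in> A"
    show "a k powr p \<le> (if a k \<ge> \<delta> then 1 else 0) + \<delta> powr p"
    proof (cases "a k \<ge> \<delta>")
      case True
      have "a k powr p \<le> 1"
        using assms k by (intro powr_le1) auto
      with True show ?thesis
        by (simp add: add_increasing2)
    next
      case False
      with assms k show ?thesis
        by (auto intro!: powr_mono2)
    qed
  qed
  also have "\<dots> = real (card {k \<in> A. a k \<ge> \<delta>}) + real (card A) * \<delta> powr p"
    using assms(1) by (simp add: sum.distrib sum.If_cases Collect_conj_eq)
  finally show ?thesis .
qed

text \<open>The analytic core, free of probability: \<open>a k\<close> stands for the deviation
  probability at one fixed \<epsilon>.\<close>

lemma Cesaro_powr_iff_stat_conv:
  fixes a :: "nat \<Rightarrow> real"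
  assumes p: "p > 0" and a: "\<And>k. 0 \<le> a k" "\<And>k. a k \<le> 1"
  shows "(\<lambda>n. (\<Sum>k=1..n. a k powr p) / real n) \<longlonglongrightarrow> 0 \<longleftrightarrow>
    (\<forall>\<delta>>0. (\<lambda>n. real (card {k \<in> {1..n}. a k \<ge> \<delta>}) / real n) \<longlonglongrightarrow> 0)"
    (is "?S \<longlonglongrightarrow> 0 \<longleftrightarrow> (\<forall>\<delta>>0. ?C \<delta> \<longlonglongrightarrow> 0)")
proof (intro iffI allI impI)
  fix \<delta> :: real
  assume S: "?S \<longlonglongrightarrow> 0" and \<delta>: "\<delta> > 0"
  have "(\<lambda>n. ?S n / \<delta> powr p) \<longlonglongrightarrow> 0"
    using tendsto_divide_zero[OF S] .
  then show "?C \<delta> \<longlonglongrightarrow> 0"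
  \<comment> \<open>The densities are squeezed between 0 and the Cesaro means scaled by the constant
    \<open>1 / \<delta> powr p\<close>.\<close>
  proof (rule tendsto_sandwich[OF _ _ tendsto_const, rotated 2])
    have "?C \<delta> n \<le> ?S n / \<delta> powr p" for n
    proof -
      have "real (card {k \<in> {1..n}. a k \<ge> \<delta>}) \<le> (\<Sum>k=1..n. a k powr p) / \<delta> powr p"
        using card_mult_powr_le_sum_powr[of "{1..n}" p \<delta> a] p \<delta>
        by (simp add: field_simps)
      from divide_right_mono[OF this, of "real n"] show ?thesis
        by (simp add: field_simps)
    qed
    then show "eventually (\<lambda>n. ?C \<delta> n \<le> ?S n / \<delta> powr p) sequentially"
      by simp
  qed simp
next
  assume C: "\<forall>\<delta>>0. ?C \<delta> \<longlonglongrightarrow> 0"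
  show "?S \<longlonglongrightarrow> 0"
  proof (rule LIMSEQ_I)
    fix r :: real
    assume r: "r > 0"
    \<comment> \<open>Chosen so that \<open>\<delta> powr p = r / 2\<close>: after division by
      \<open>n\<close> the small terms use up half of \<open>r\<close>, leaving the other half for
      the density.\<close>
    define \<delta> where "\<delta> = (r / 2) powr (1 / p)"
    have \<delta>: "\<delta> > 0" "\<delta> powr p = r / 2"
      using r p by (auto simp: \<delta>_def powr_powr)
    have "r / 2 > 0" using r by simp
    with C \<delta>(1) obtain N where N: "\<And>n. n \<ge> N \<Longrightarrow> norm (?C \<delta> n - 0) < r / 2"
      by (meson LIMSEQ_D)
    have "norm (?S n - 0) < r" if n: "n \<ge> N" for n
    \<comment> \<open>\<open>N\<close> may be 0, and cancelling \<open>n\<close> needs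
      \<open>n \<noteq> 0\<close>; at 0 the mean is 0 by the convention for division.\<close>
    proof (cases "n = 0")
      case False
      have "?S n \<le> (real (card {k \<in> {1..n}. a k \<ge> \<delta>}) + real n * (r / 2)) / real n"
        using sum_powr_le_card_plus[of "{1..n}" p a \<delta>] p a \<delta>(2)
        by (intro divide_right_mono) auto
      also have "\<dots> = ?C \<delta> n + r / 2"
        using False by (simp add: add_divide_distrib)
      also have "\<dots> < r"
        using N[OF n] unfolding real_norm_def by linarith
      finally show ?thesis
        by (simp add: sum_nonneg)
    qed (use r in simp)
    then show "\<exists>N. \<forall>n\<ge>N. norm (?S n - 0) < r"
      by blast
  qed
qed

text \<open>The two modes already agree for each \<epsilon> separately and with the same limit
  \<open>Y\<close>, so equality of the classes follows by unfolding.\<close>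

lemma (in prob_space) strong_Cesaro_in_prob_iff_stat_conv_in_prob:
  assumes "p > 0"
  shows "strong_Cesaro_in_prob M p 1 X Y \<longleftrightarrow> stat_conv_in_prob M 1 X Y"
proof -
  have "(\<lambda>n. (\<Sum>k=1..n. prob {\<omega> \<in> space M. \<bar>X k \<omega> - Y \<omega>\<bar> \<ge> \<epsilon>} powr p) / real n) \<longlonglongrightarrow> 0 \<longleftrightarrow>
    (\<forall>\<delta>>0. (\<lambda>n. real (card {k \<in> {1..n}. prob {\<omega> \<in> space M. \<bar>X k \<omega> - Y \<omega>\<bar> \<ge> \<epsilon>} \<ge> \<delta>})
      / real n) \<longlonglongrightarrow> 0)" for \<epsilon>
    using assms by (rule Cesaro_powr_iff_stat_conv) auto
  moreover have "real n powr 1 = real n" for n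
    by simp
  ultimately show ?thesis
    unfolding strong_Cesaro_in_prob_def stat_conv_in_prob_def by presburger
qed

theorem theorem2p5:
  fixes M :: "'a measure" and p :: real
  assumes "prob_space M" and "p > 0"
  shows "PW M p 1 = PS M 1"
  using prob_space.strong_Cesaro_in_prob_iff_stat_conv_in_prob[OF assms]
  by (simp add: PW_def PS_def)

end
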